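(* Let $X=Y=(\mathbb{R},\mathcal{B}(\mathbb{R}))$, and let $\mu\in\mathcal{G}X$ be absolutely continuous with respect to the Borel measure $m$ on $\mathbb{R}$ (i.e. $m(A)=0\implies\mu(A)=0$ for any $A\in\Sigma_X$). Then $$\mathrm{G}_{X,Y}^{-1}\bigl(\langle\!\langle \mu,\ \mathrm{ev}_{\{0\}}^{-1}(\{1\})\rangle\!\rangle\bigr)\notin\Sigma_{X\multimap Y}.$$
   Context: For a measurable space $X$, $|X|$ denotes its underlying set and $\Sigma_X$ its $\sigma$-algebra. $\mathbf{Meas}(X,Y)$ is the set of measurable functions $X\to Y$. $\mathcal{B}(\mathbb{R})$ is the Borel $\sigma$-algebra on $\mathbb{R}$, and $m$ is the unique measure on $\mathcal{B}(\mathbb{R})$ with $m([\alpha,\beta))=\beta-\alpha$. For measurable spaces $X,Y$, $X\multimap Y=(\mathbf{Meas}(X,Y),\Sigma_{X\multimap Y})$, where $\Sigma_{X\multimap Y}$ is the $\sigma$-algebra generated by the sets $\langle\!\langle x,U\rangle\!\rangle=\{f\in\mathbf{Meas}(X,Y)\mid f(x)\in U\}$ for $x\in|X|$, $U\in\Sigma_Y$. $\mathcal{G}X$ (Giry monad) is the measurable space whose underlying set is the set of probability measures on $X$, with the coarsest $\sigma$-algebra making every evaluation $\mathrm{ev}_A\colon\mathcal{G}X\to[0,1]$, $\nu\mapsto\nu(A)$ ($A\in\Sigma_X$), measurable, where $[0,1]$ has its Borel $\sigma$-algebra. For measurable $f\colon X\to Y$, $\mathcal{G}f\colon\mathcal{G}X\to\mathcal{G}Y$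 is $(\mathcal{G}f)(\mu)=\mu(f^{-1}(-))$. $\mathrm{G}_{X,Y}\colon\mathbf{Meas}(X,Y)\to\mathbf{Meas}(\mathcal{G}X,\mathcal{G}Y)$ is the function $f\mapsto\mathcal{G}f$. In the claim, $\mathrm{ev}_{\{0\}}\colon\mathcal{G}Y\to[0,1]$, and $\langle\!\langle \mu,\mathrm{ev}_{\{0\}}^{-1}(\{1\})\rangle\!\rangle=\{g\in\mathbf{Meas}(\mathcal{G}X,\mathcal{G}Y)\mid g(\mu)\in\mathrm{ev}_{\{0\}}^{-1}(\{1\})\}$, a measurable subset of $\mathcal{G}X\multimap\mathcal{G}Y$. *)

theory Defs
  imports "HOL-Probability.Probability"
begin

text \<open>
  Measurable spaces are represented by the library type of measures, of which only
  \<^term>\<open>space\<close> and \<^term>\<open>sets\<close> are used.  The Giry monad is the library's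
  \<^const>\<open>prob_algebra\<close>; lemma \<open>sets_prob_algebra_eq\<close> below confirms that it carries the coarsest
  \<open>\<sigma>\<close>-algebra making all evaluations measurable.
\<close>

text \<open>
  \<^const>\<open>measurable\<close> does not constrain functions outside the space of their domain. To have exactly
  one HOL function for each measurable map, they are required to be \<^const>\<open>undefined\<close> there
  (no restriction when the domain is all of the type, but relevant for \<^term>\<open>prob_algebra X\<close>).
\<close>

definition Meas :: "'a measure \<Rightarrow> 'b measure \<Rightarrow> ('a \<Rightarrow> 'b) set" where
  "Meas X Y = (X \<rightarrow>\<^sub>M Y) \<inter> extensional (space X)"

definition eval_set :: "'a measure \<Rightarrow> 'b measure \<Rightarrow> 'a \<Rightarrow> 'b set \<Rightarrow> ('a \<Rightarrow> 'b) set" where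
  "eval_set X Y x U = {f \<in> Meas X Y. f x \<in> U}"

definition meas_hom :: "'a measure \<Rightarrow> 'b measure \<Rightarrow> ('a \<Rightarrow> 'b) measure"  (infixr \<open>\<multimap>\<close> 60) where
  "X \<multimap> Y = sigma (Meas X Y) {eval_set X Y x U | x U. x \<in> space X \<and> U \<in> sets Y}"

definition giry_map :: "'a measure \<Rightarrow> 'b measure \<Rightarrow> ('a \<Rightarrow> 'b) \<Rightarrow> ('a measure \<Rightarrow> 'b measure)" where
  "giry_map X Y f = (\<lambda>\<nu>\<in>space (prob_algebra X). distr \<nu> Y f)"

definition eval_at :: "'a set \<Rightarrow> 'a measure \<Rightarrow> real" where
  "eval_at A \<nu> = measure \<nu> A"

lemma space_meas_hom: "space (X \<multimap> Y) = Meas X Y"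
  unfolding meas_hom_def by (rule space_measure_of) (auto simp: eval_set_def)

lemma sets_meas_hom:
  "sets (X \<multimap> Y) =
     sigma_sets (Meas X Y) {eval_set X Y x U | x U. x \<in> space X \<and> U \<in> sets Y}"
  unfolding meas_hom_def by (rule sets_measure_of) (auto simp: eval_set_def)

lemma eval_set_in_sets:
  "x \<in> space X \<Longrightarrow> U \<in> sets Y \<Longrightarrow> eval_set X Y x U \<in> sets (X \<multimap> Y)"
  unfolding sets_meas_hom by (rule sigma_sets.Basic) auto

lemma giry_map_in_Meas:
  assumes "f \<in> Meas X Y"
  shows "giry_map X Y f \<in> Meas (prob_algebra X) (prob_algebra Y)"
proof -
  have f: "f \<in> X \<rightarrow>\<^sub>M Y"
    using assms by (simp add: Meas_def)
  have "(\<lambda>\<nu>. distr \<nu> Y f) \<in> prob_algebra X \<rightarrow>\<^sub>M prob_algebra Y"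
    by (rule measurable_distr_prob_space[OF f])
  moreover have "(\<lambda>\<nu>. distr \<nu> Y f) \<in> prob_algebra X \<rightarrow>\<^sub>M prob_algebra Y \<longleftrightarrow>
      giry_map X Y f \<in> prob_algebra X \<rightarrow>\<^sub>M prob_algebra Y"
    by (rule measurable_cong) (simp add: giry_map_def)
  ultimately show ?thesis
    by (simp add: Meas_def giry_map_def)
qed

lemma giry_map_apply:
  assumes "f \<in> Meas X Y" "\<nu> \<in> space (prob_algebra X)" "A \<in> sets Y"
  shows "emeasure (giry_map X Y f \<nu>) A = emeasure \<nu> (f -` A \<inter> space X)"
proof -
  have "sets \<nu> = sets X"
    using assms(2) by (simp add: space_prob_algebra)
  moreover from this have "f \<in> \<nu> \<rightarrow>\<^sub>M Y"
    using assms(1) measurable_cong_sets[of \<nu> X Y Y] by (simp add: Meas_def)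
  moreover have "space \<nu> = space X"
    by (rule sets_eq_imp_space_eq) fact
  ultimately show ?thesis
    using assms(2,3) by (simp add: giry_map_def emeasure_distr)
qed

lemma sets_prob_algebra_eq:
  "sets (prob_algebra X) =
     sigma_sets (space (prob_algebra X))
       {eval_at A -` U \<inter> space (prob_algebra X) | A U.
          A \<in> sets X \<and> U \<in> sets (restrict_space borel {0..1})}"
  (is "_ = sigma_sets ?S ?G")
proof -
  have ev_range: "eval_at A \<in> ?S \<rightarrow> {0..1}" for A
    by (auto simp: eval_at_def space_prob_algebra prob_space.prob_le_1)
  have "?G \<subseteq> sets (prob_algebra X)"
  proof safe
    fix A :: "'a set" and U :: "real set"
    assume A: "A \<in> sets X" and U: "U \<in> sets (restrict_space borel {0..1})"
    have "eval_at A \<in> prob_algebra X \<rightarrow>\<^sub>M restrict_space borel {0..1}"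
      using ev_range[of A] A
      by (intro measurable_restrict_space2) (auto simp: eval_at_def[abs_def])
    then show "eval_at A -` U \<inter> ?S \<in> sets (prob_algebra X)"
      using U by (rule measurable_sets)
  qed
  then have le: "sigma_sets ?S ?G \<subseteq> sets (prob_algebra X)"
    by (rule sets.sigma_sets_subset)
  let ?N = "sigma ?S ?G"
  have space_N: "space ?N = ?S" and sets_N: "sets ?N = sigma_sets ?S ?G"
    by (auto intro!: space_measure_of sets_measure_of)
  have ev_N: "eval_at A \<in> borel_measurable ?N" if A: "A \<in> sets X" for A
  proof -
    have "eval_at A \<in> ?N \<rightarrow>\<^sub>M restrict_space borel {0..1}"
    proof (rule measurableI)
      show "eval_at A x \<in> space (restrict_space borel {0..1})" if "x \<in> space ?N" for x
        using that ev_range[of A] by (auto simp: space_N space_restrict_space)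
      show "eval_at A -` U \<inter> space ?N \<in> sets ?N" if "U \<in> sets (restrict_space borel {0..1})" for U
        unfolding space_N sets_N using A that by (intro sigma_sets.Basic) blast
    qed
    then show ?thesis
      by (simp add: measurable_restrict_space2_iff)
  qed
  have id: "(\<lambda>\<nu>. \<nu>) \<in> ?N \<rightarrow>\<^sub>M prob_algebra X"
  proof (rule measurable_prob_algebraI)
    show "prob_space \<nu>" if "\<nu> \<in> space ?N" for \<nu>
      using that unfolding space_N by (simp add: space_prob_algebra)
    show "(\<lambda>\<nu>. \<nu>) \<in> ?N \<rightarrow>\<^sub>M subprob_algebra X"
    proof (rule measurable_subprob_algebra)
      fix \<nu> assume "\<nu> \<in> space ?N"
      then have "prob_space \<nu>" "sets \<nu> = sets X"
        unfolding space_N by (simp_all add: space_prob_algebra)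
      then show "subprob_space \<nu>" "sets \<nu> = sets X"
        by (simp_all add: prob_space_imp_subprob_space)
    next
      fix A assume "A \<in> sets X"
      then have "(\<lambda>\<nu>. ennreal (eval_at A \<nu>)) \<in> borel_measurable ?N"
        by (rule measurable_compose[OF ev_N measurable_ennreal])
      moreover have "ennreal (eval_at A \<nu>) = emeasure \<nu> A" if "\<nu> \<in> space ?N" for \<nu>
      proof -
        have "prob_space \<nu>"
          using that unfolding space_N by (simp add: space_prob_algebra)
        then interpret prob_space \<nu> .
        show ?thesis
          by (simp add: eval_at_def emeasure_eq_measure)
      qed
      ultimately show "(\<lambda>\<nu>. emeasure \<nu> A) \<in> borel_measurable ?N"
        using measurable_cong[of ?N "\<lambda>\<nu>. ennreal (eval_at A \<nu>)" "\<lambda>\<nu>. emeasure \<nu> A" borel]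
        by blast
    qed
  qed
  have "B \<in> sigma_sets ?S ?G" if "B \<in> sets (prob_algebra X)" for B
  proof -
    have "B \<inter> ?S \<in> sets ?N"
      using measurable_sets[OF id that] by (simp add: space_N)
    then show ?thesis
      using sets.sets_into_space[OF that] by (simp add: sets_N Int_absorb2)
  qed
  with le show ?thesis
    by blast
qed

end

theory Submission
  imports Defs
begin

text \<open>
  A member of a \<open>\<sigma>\<close>-algebra generated by evaluations at single points can only test a function at
  countably many points (\<open>meas_hom_sets_countable_support\<close>).  The preimage in question consists of
  the \<open>f\<close> with \<open>\<mu> (f -` {0}) = 1\<close> (\<open>giry_map_mem_eval_set_iff\<close>), and such a condition is blind to
  countable sets, because an absolutely continuous \<open>\<mu>\<close> gives them mass zero.  If the preimage were
  measurable, with countable support \<open>C\<close>, then the zero function and the indicator of \<open>- C\<close>, which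
  agree on \<open>C\<close>, would both belong to it or both not.  But the first vanishes everywhere and the
  second only on the null set \<open>C\<close>.
\<close>

definition determined_on :: "('a \<Rightarrow> 'b) set \<Rightarrow> 'a set \<Rightarrow> ('a \<Rightarrow> 'b) set \<Rightarrow> bool" where
  "determined_on F C S \<longleftrightarrow>
     (\<forall>f\<in>F. \<forall>g\<in>F. (\<forall>x\<in>C. f x = g x) \<longrightarrow> (f \<in> S \<longleftrightarrow> g \<in> S))"

lemma determined_on_UN:
  assumes "\<And>i. i \<in> I \<Longrightarrow> determined_on F (C i) (S i)"
  shows "determined_on F (\<Union>i\<in>I. C i) (\<Union>i\<in>I. S i)"
  unfolding determined_on_def
proof (intro ballI impI)
  fix f g assume fg: "f \<in> F" "g \<in> F" and eq: "\<forall>x\<in>(\<Union>i\<in>I. C i). f x = g x"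
  have "f \<in> S i \<longleftrightarrow> g \<in> S i" if "i \<in> I" for i
    using assms[OF that] fg eq that unfolding determined_on_def by blast
  then show "f \<in> (\<Union>i\<in>I. S i) \<longleftrightarrow> g \<in> (\<Union>i\<in>I. S i)"
    by simp
qed

text \<open>
  The sets determined by countably many coordinates form a \<open>\<sigma>\<close>-algebra, since a countable union of
  countable supports is countable, and each generator is determined by a single coordinate.
\<close>

lemma meas_hom_sets_countable_support:
  assumes "S \<in> sets (X \<multimap> Y)"
  shows "\<exists>C. countable C \<and> C \<subseteq> space X \<and> determined_on (Meas X Y) C S"
  using assms unfolding sets_meas_hom
proof (induction rule: sigma_sets.induct)
  case (Basic S)
  then obtain x U where "S = eval_set X Y x U" "x \<in> space X"
    by blast
  then show ?case
    by (intro exI[of _ "{x}"]) (simp add: eval_set_def determined_on_def)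
next
  case Empty
  show ?case
    by (intro exI[of _ "{}"]) (simp add: determined_on_def)
next
  case (Compl S)
  then obtain C where "countable C" "C \<subseteq> space X" "determined_on (Meas X Y) C S"
    by blast
  then show ?case
    unfolding determined_on_def by blast
next
  case (Union S)
  have "\<forall>i. \<exists>C. countable C \<and> C \<subseteq> space X \<and> determined_on (Meas X Y) C (S i)"
    using Union.IH by (rule allI)
  then obtain C where "\<And>i. countable (C i)" "\<And>i. C i \<subseteq> space X"
    and "\<And>i. determined_on (Meas X Y) (C i) (S i)"
    by (auto dest!: choice)
  then show ?case
    by (intro exI[of _ "\<Union>i. C i"] conjI determined_on_UN countable_UN) auto
qed

lemma giry_map_mem_eval_set_iff:
  assumes f: "f \<in> Meas X Y" and \<mu>: "\<mu> \<in> space (prob_algebra X)" and A: "A \<in> sets Y"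
  shows "giry_map X Y f \<in> eval_set (prob_algebra X) (prob_algebra Y) \<mu>
      (eval_at A -` {p} \<inter> space (prob_algebra Y)) \<longleftrightarrow> measure \<mu> (f -` A \<inter> space X) = p"
proof -
  have G: "giry_map X Y f \<in> Meas (prob_algebra X) (prob_algebra Y)"
    by (rule giry_map_in_Meas[OF f])
  then have "giry_map X Y f \<mu> \<in> space (prob_algebra Y)"
    using \<mu> by (auto simp: Meas_def intro: measurable_space)
  moreover have "eval_at A (giry_map X Y f \<mu>) = measure \<mu> (f -` A \<inter> space X)"
    using giry_map_apply[OF f \<mu> A] by (simp add: eval_at_def measure_def)
  ultimately show ?thesis
    using G by (auto simp: eval_set_def)
qed

theorem theorem2:
  fixes \<mu> :: "real measure"
  assumes "\<mu> \<in> space (prob_algebra (borel :: real measure))"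
    and "absolutely_continuous lborel \<mu>"
  shows "giry_map (borel :: real measure) (borel :: real measure) -`
           eval_set (prob_algebra borel) (prob_algebra borel) \<mu>
             (eval_at {0} -` {1} \<inter> space (prob_algebra borel))
         \<inter> Meas borel borel
         \<notin> sets ((borel :: real measure) \<multimap> (borel :: real measure))"
    (is "?S \<notin> _")
proof
  interpret prob_space \<mu>
    using assms(1) by (simp add: space_prob_algebra)
  have space_\<mu>: "space \<mu> = UNIV"
    using assms(1) by (simp add: space_prob_algebra sets_eq_imp_space_eq)
  have mem_S: "f \<in> ?S \<longleftrightarrow> prob (f -` {0}) = 1" if "f \<in> Meas borel borel" for f
    using giry_map_mem_eval_set_iff[OF that assms(1), of "{0}" 1] that by simp
  assume "?S \<in> sets ((borel :: real measure) \<multimap> (borel :: real measure))"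
  then obtain C where C: "countable C" and det: "determined_on (Meas borel borel) C ?S"
    using meas_hom_sets_countable_support by blast
  define z g :: "real \<Rightarrow> real" where "z = (\<lambda>_. 0)" and "g = indicator (- C)"
  have "C \<in> sets borel"
    using C by (rule sets.countable[rotated]) simp
  then have Meas: "z \<in> Meas borel borel" "g \<in> Meas borel borel"
    by (auto simp: Meas_def z_def g_def)
  have "prob (z -` {0}) = 1"
    using prob_space by (simp add: z_def space_\<mu>)
  with Meas have "z \<in> ?S"
    by (simp only: mem_S)
  moreover have "\<forall>x\<in>C. z x = g x"
    by (simp add: z_def g_def)
  ultimately have "g \<in> ?S"
    using det Meas unfolding determined_on_def by blast
  moreover have "g -` {0} = C"
    by (auto simp: g_def indicator_def)
  ultimately have "prob C = 1"
    using mem_S[OF Meas(2)] by simp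
  moreover have "C \<in> null_sets \<mu>"
    using assms(2) countable_imp_null_set_lborel[OF C] by (auto simp: absolutely_continuous_def)
  ultimately show False
    by (simp add: measure_eq_0_null_sets)
qed

end
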